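(* There exists a non-deterministic communication protocol in the two-party edge-partition model that, given an $n$-vertex graph $G$ with maximum degree $\Delta$, finds a proper $(\Delta+1)$-coloring of $G$ using $O(n)$ bits of communication.
   Context: Two-party edge-partition model: the input is an undirected graph $G=(V,E)$ on vertex set $[n]$ with maximum degree $\Delta$; $E$ is partitioned into disjoint sets $E_A$ (Alice's) and $E_B$ (Bob's); both players know $n$ and $\Delta$. Non-deterministic version: a prover who knows all edges of $G$ sends a single message to both Alice and Bob; Alice and Bob do not communicate with each other; each either accepts or rejects, and they must agree on a coloring of all vertices. Correctness: for every input there is a prover message that both accept, and whenever the prover's message encodes an improper coloring at least one of them rejects. The cost of the protocol is the length (in bits) of the prover's message. A coloring $C\in[\Delta+1]^n$ is proper if $C(u)\ne C(v)$ for every edge $\{u,v\}\in E$. *)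

theory Defs
  imports Main "HOL-Library.FuncSet"
begin

text \<open>Simple undirected graphs on the vertex set \<open>{1..n}\<close>, given by their set of two-element edges.\<close>

definition simple_graph :: "nat \<Rightarrow> nat set set \<Rightarrow> bool" where
  "simple_graph n E \<longleftrightarrow> (\<forall>e\<in>E. e \<subseteq> {1..n} \<and> card e = 2)"

definition degree :: "nat set set \<Rightarrow> nat \<Rightarrow> nat" where
  "degree E v = card {e \<in> E. v \<in> e}"

text \<open>On \<^typ>\<open>nat\<close>, the supremum of the empty set is 0, so the graph without vertices has
  maximum degree 0.\<close>

definition max_degree :: "nat \<Rightarrow> nat set set \<Rightarrow> nat" where
  "max_degree n E = (SUP v\<in>{1..n}. degree E v)"

text \<open>Colorings are extensional functions (undefined outside \<open>{1..n}\<close>), so that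
  equality of colorings is equality on the vertices.\<close>

definition proper_coloring :: "nat \<Rightarrow> nat \<Rightarrow> nat set set \<Rightarrow> (nat \<Rightarrow> nat) \<Rightarrow> bool" where
  "proper_coloring n k E C \<longleftrightarrow>
     C \<in> {1..n} \<rightarrow>\<^sub>E {1..k} \<and> (\<forall>u v. {u, v} \<in> E \<longrightarrow> C u \<noteq> C v)"

definition edge_partition_input ::
    "nat \<Rightarrow> nat \<Rightarrow> nat set set \<Rightarrow> nat set set \<Rightarrow> bool" where
  "edge_partition_input n \<Delta> EA EB \<longleftrightarrow>
     simple_graph n (EA \<union> EB) \<and> EA \<inter> EB = {} \<and> max_degree n (EA \<union> EB) = \<Delta>"

text \<open>The prover's messages are the bit strings of length \<open>msg_length\<close>, and \<open>encoded m\<close> is the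
  coloring encoded by \<open>m\<close> (a message that is no meaningful encoding may be sent to any function
  outside the set of colorings). Each player sees only their own edges and the message, and either
  rejects (\<^const>\<open>None\<close>) or accepts and outputs a coloring.\<close>

record nd_protocol =
  msg_length :: nat
  encoded :: "bool list \<Rightarrow> (nat \<Rightarrow> nat)"
  alice :: "nat set set \<Rightarrow> bool list \<Rightarrow> (nat \<Rightarrow> nat) option"
  bob :: "nat set set \<Rightarrow> bool list \<Rightarrow> (nat \<Rightarrow> nat) option"

text \<open>The three conjuncts: some message is accepted by both players; a message that does not encode
  a proper \<open>(\<Delta> + 1)\<close>-coloring is rejected by at least one of them; if both accept, they agree on
  the encoded coloring.\<close>

definition nd_coloring_protocol :: "nat \<Rightarrow> nat \<Rightarrow> nd_protocol \<Rightarrow> bool" where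
  "nd_coloring_protocol n \<Delta> P \<longleftrightarrow>
     (\<forall>EA EB. edge_partition_input n \<Delta> EA EB \<longrightarrow>
        (\<exists>m. length m = msg_length P \<and> alice P EA m \<noteq> None \<and> bob P EB m \<noteq> None) \<and>
        (\<forall>m. length m = msg_length P \<longrightarrow>
           \<not> proper_coloring n (\<Delta> + 1) (EA \<union> EB) (encoded P m) \<longrightarrow>
           alice P EA m = None \<or> bob P EB m = None) \<and>
        (\<forall>m CA CB. length m = msg_length P \<longrightarrow>
           alice P EA m = Some CA \<longrightarrow> bob P EB m = Some CB \<longrightarrow>
           CA = encoded P m \<and> CB = encoded P m))"

end

theory Submission
  imports Defs Complex_Main
begin

text \<open>
  It suffices to find \<open>16 ^ n\<close> colorings such that every graph of maximum degree \<open>\<Delta>\<close> is properly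
  colored by one of them: the message is an index into this family, and each player checks their
  own edges. Coloring the vertices greedily in a given order yields at least
  \<open>\<Prod>v. q - (number of earlier neighbors of v)\<close> proper colorings with \<open>q = \<Delta> + 1\<close> colors, and in a
  uniformly random order a vertex of degree \<open>d\<close> has a uniform number of earlier neighbors in
  \<open>{0..d}\<close>. Averaging the logarithm of the product shows that some order gives at least
  \<open>(q / e) ^ n\<close> proper colorings, i.e. at least a fraction \<open>e ^ (-n)\<close> of all colorings is proper. As there are at most \<open>2 ^ (n\<^sup>2)\<close> graphs, a greedily chosen
  family of \<open>16 ^ n\<close> colorings serves all of them.
\<close>

section \<open>Extending proper colorings by one vertex\<close>

text \<open>The vertex set \<open>S\<close> is a separate parameter, so an induction can delete
  vertices while \<open>E\<close> stays fixed; edges leaving \<open>S\<close> impose no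
  constraint.\<close>

definition proper_colorings :: "nat \<Rightarrow> 'a set set \<Rightarrow> 'a set \<Rightarrow> ('a \<Rightarrow> nat) set" where
  "proper_colorings q E S =
     {C \<in> S \<rightarrow>\<^sub>E {1..q}. \<forall>u\<in>S. \<forall>v\<in>S. {u, v} \<in> E \<longrightarrow> C u \<noteq> C v}"

definition nbrs :: "'a set set \<Rightarrow> 'a set \<Rightarrow> 'a \<Rightarrow> 'a set" where
  "nbrs E S v = {u \<in> S. {u, v} \<in> E}"

lemma finite_nbrs: "finite S \<Longrightarrow> finite (nbrs E S v)"
  by (simp add: nbrs_def)

lemma finite_proper_colorings: "finite S \<Longrightarrow> finite (proper_colorings q E S)"
  by (rule finite_subset[of _ "S \<rightarrow>\<^sub>E {1..q}"]) (auto simp: proper_colorings_def intro: finite_PiE)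

text \<open>One greedy step: the neighbors of \<open>v\<close> block at most
  \<open>card (nbrs E S v)\<close> colors, and distinct pairs of a coloring and a free color give
  distinct extensions. A loop at \<open>v\<close> would leave no proper coloring of
  \<open>insert v S\<close>.\<close>

lemma card_proper_colorings_insert:
  assumes "finite S" "v \<notin> S" "{v} \<notin> E"
  shows "(q - card (nbrs E S v)) * card (proper_colorings q E S)
           \<le> card (proper_colorings q E (insert v S))"
proof -
  let ?free = "\<lambda>C. {1..q} - C ` nbrs E S v"
  let ?ext = "\<lambda>(C, c). C(v := c)"
  have free: "q - card (nbrs E S v) \<le> card (?free C)" for C
  proof -
    have "q - card (nbrs E S v) \<le> card {1..q} - card (C ` nbrs E S v)"
      using card_image_le[OF finite_nbrs[OF assms(1)], of C E v] by simp
    also have "\<dots> \<le> card (?free C)"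
      by (rule diff_card_le_card_Diff) (simp add: finite_nbrs assms)
    finally show ?thesis .
  qed
  have inj: "inj_on ?ext (Sigma (proper_colorings q E S) ?free)"
  proof (rule inj_onI, clarify)
    fix C c C' c'
    assume C: "C \<in> proper_colorings q E S" "C' \<in> proper_colorings q E S"
      and eq: "C(v := c) = C'(v := c')"
    have "C x = C' x" for x
    proof (cases "x = v")
      case True
      then show ?thesis
        \<comment> \<open>By extensionality both colorings are \<open>undefined\<close> at
          \<open>v\<close>, so the update erases no information.\<close>
        using C assms(2) by (auto simp: proper_colorings_def PiE_def extensional_def)
    next
      case False
      then show ?thesis
        using fun_cong[OF eq, of x] by simp
    qed
    then show "C = C' \<and> c = c'"
      using fun_cong[OF eq, of v] by auto
  qed
  have sub: "?ext ` Sigma (proper_colorings q E S) ?free \<subseteq> proper_colorings q E (insert v S)"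
  proof clarify
    fix C c
    assume C: "C \<in> proper_colorings q E S" and c: "c \<in> {1..q}" "c \<notin> C ` nbrs E S v"
    have "(C(v := c)) a \<noteq> (C(v := c)) b"
      if "a \<in> insert v S" "b \<in> insert v S" "{a, b} \<in> E" for a b
      using that C c assms by (auto simp: proper_colorings_def nbrs_def insert_commute)
    moreover have "C(v := c) \<in> insert v S \<rightarrow>\<^sub>E {1..q}"
      using C c by (intro PiE_fun_upd) (auto simp: proper_colorings_def)
    ultimately show "C(v := c) \<in> proper_colorings q E (insert v S)"
      unfolding proper_colorings_def by blast
  qed
  have "(q - card (nbrs E S v)) * card (proper_colorings q E S)
      = (\<Sum>C\<in>proper_colorings q E S. q - card (nbrs E S v))"
    by simp
  also have "\<dots> \<le> (\<Sum>C\<in>proper_colorings q E S. card (?free C))"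
    by (intro sum_mono free)
  also have "\<dots> = card (Sigma (proper_colorings q E S) ?free)"
    by (simp add: card_SigmaI finite_proper_colorings assms)
  also have "\<dots> = card (?ext ` Sigma (proper_colorings q E S) ?free)"
    by (rule card_image[OF inj, symmetric])
  also have "\<dots> \<le> card (proper_colorings q E (insert v S))"
    by (intro card_mono finite_proper_colorings sub) (simp add: assms)
  finally show ?thesis .
qed

section \<open>Average logarithm of the number of free colors\<close>

text \<open>The expected logarithm of the number of free colors at a vertex of degree
  \<open>d\<close>, when its number \<open>j\<close> of earlier neighbors is uniform in
  \<open>{0..d}\<close>.\<close>

definition mean_log :: "nat \<Rightarrow> nat \<Rightarrow> real" where
  "mean_log q d = (\<Sum>j\<le>d. ln (real (q - j))) / real (Suc d)"

lemma mean_log_Suc: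
  "real (Suc (Suc d)) * mean_log q (Suc d) = real (Suc d) * mean_log q d + ln (real (q - Suc d))"
  by (simp add: mean_log_def)

text \<open>The elementary half of Stirling's formula; the induction step is
  \<open>(1 + 1 / k) ^ k \<le> exp 1\<close>.\<close>

lemma power_le_exp_times_fact: "real k ^ k \<le> exp (real k) * fact k"
proof (induction k)
  case 0
  show ?case by simp
next
  case (Suc k)
  have "real (Suc k) ^ k \<le> exp 1 * real k ^ k"
  proof (cases "k = 0")
    case False
    have "real (Suc k) ^ k = real k ^ k * (1 + 1 / real k) ^ k"
      using False by (simp add: power_mult_distrib[symmetric] field_simps)
    also have "\<dots> \<le> real k ^ k * exp (1 / real k) ^ k"
      by (intro mult_left_mono power_mono exp_ge_add_one_self) auto
    also have "exp (1 / real k) ^ k = exp 1"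
      using False by (simp add: exp_of_nat_mult[symmetric])
    finally show ?thesis by (simp add: mult.commute)
  qed simp
  also have "\<dots> \<le> exp 1 * (exp (real k) * fact k)"
    by (intro mult_left_mono Suc.IH) auto
  finally have "real (Suc k) * real (Suc k) ^ k \<le> real (Suc k) * (exp 1 * (exp (real k) * fact k))"
    by (intro mult_left_mono) auto
  then show ?case
    by (simp add: exp_add mult_ac)
qed

text \<open>The product of the numbers \<open>q - j\<close>, \<open>j \<le> d\<close>, is \<open>(q choose k) * k!\<close> with \<open>k = d + 1\<close>,
  which is at least \<open>(q / k) ^ k * (k / e) ^ k\<close>.\<close>

lemma mean_log_ge:
  assumes "d < q"
  shows "ln (real q) - 1 \<le> mean_log q d"
proof -
  let ?k = "Suc d"
  have "(real q / real ?k) ^ ?k * real ?k ^ ?k \<le> real (q choose ?k) * (exp (real ?k) * fact ?k)"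
    using assms
    by (intro mult_mono binomial_ge_n_over_k_pow_k power_le_exp_times_fact) auto
  then have "real q ^ ?k \<le> exp (real ?k) * (fact ?k * real (q choose ?k))"
    by (simp add: power_divide mult_ac del: power_Suc fact_Suc)
  also have "fact ?k * real (q choose ?k) = (\<Prod>j\<le>d. real (q - j))"
    using assms
    by (simp add: binomial_gbinomial gbinomial_mult_fact atLeast0AtMost atLeast0LessThan
          lessThan_Suc_atMost del: fact_Suc)
  finally have "ln (real q ^ ?k) \<le> ln (exp (real ?k) * (\<Prod>j\<le>d. real (q - j)))"
    using assms by (intro ln_mono) auto
  also have "\<dots> = real ?k + ln (\<Prod>j\<le>d. real (q - j))"
    using assms by (subst ln_mult_pos) (auto intro!: prod_pos)
  also have "ln (\<Prod>j\<le>d. real (q - j)) = (\<Sum>j\<le>d. ln (real (q - j)))"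
    using assms by (intro ln_prod) auto
  finally have "real ?k * (ln (real q) - 1) \<le> (\<Sum>j\<le>d. ln (real (q - j)))"
    using assms by (simp add: ln_realpow algebra_simps del: power_Suc)
  then show ?thesis
    by (simp add: mean_log_def field_simps)
qed

text \<open>Deleting a neighbor of \<open>u\<close> replaces the degree \<open>d\<close> of \<open>u\<close> by \<open>d - 1\<close>, and there are \<open>d\<close> such
  neighbors. The choice of \<^const>\<open>mean_log\<close> makes the average over the deleted vertex exact.\<close>

lemma mean_log_average:
  assumes "finite S" "u \<in> S" "{u} \<notin> E"
  shows "ln (real (q - card (nbrs E S u)))
           + (\<Sum>v\<in>S - {u}. mean_log q (card (nbrs E (S - {v}) u)))
         = real (card S) * mean_log q (card (nbrs E S u))"
proof -
  let ?N = "nbrs E S u"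
  let ?d = "card ?N"
  have N: "?N \<subseteq> S - {u}" "finite ?N"
    using assms by (auto simp: nbrs_def)
  have del: "nbrs E (S - {v}) u = ?N - {v}" for v
    by (auto simp: nbrs_def)
  have "(\<Sum>v\<in>S - {u}. mean_log q (card (?N - {v})))
      = (\<Sum>v\<in>(S - {u}) - ?N. mean_log q (card (?N - {v}))) + (\<Sum>v\<in>?N. mean_log q (card (?N - {v})))"
    using N assms by (intro sum.subset_diff) auto
  also have "\<dots> = (\<Sum>v\<in>(S - {u}) - ?N. mean_log q ?d) + (\<Sum>v\<in>?N. mean_log q (?d - 1))"
    using N by (intro arg_cong2[where f = "(+)"] sum.cong) auto
  also have "\<dots> = real (card (S - {u}) - ?d) * mean_log q ?d + real ?d * mean_log q (?d - 1)"
    using N by (simp add: card_Diff_subset)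
  finally have split: "(\<Sum>v\<in>S - {u}. mean_log q (card (nbrs E (S - {v}) u)))
      = real (card (S - {u}) - ?d) * mean_log q ?d + real ?d * mean_log q (?d - 1)"
    by (simp add: del)
  have "?d \<le> card (S - {u})"
    using N assms by (intro card_mono) auto
  moreover have "card S = Suc (card (S - {u}))"
    by (rule card.remove[OF assms(1,2)])
  ultimately have rest: "real (card (S - {u}) - ?d) = real (card S) - 1 - real ?d"
    by simp
  have "ln (real (q - ?d)) + real ?d * mean_log q (?d - 1) = real (Suc ?d) * mean_log q ?d"
  proof (cases ?d)
    \<comment> \<open>Here \<open>?d - 1\<close> truncates to 0, but its term carries the factor
      \<open>?d\<close>, which is 0.\<close>
    case 0
    then show ?thesis by (simp add: mean_log_def)
  next
    case (Suc d)
    then show ?thesis using mean_log_Suc[of d q] by simp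
  qed
  then show ?thesis
    unfolding split rest by (simp add: algebra_simps)
qed

section \<open>Counting proper colorings along a good vertex order\<close>

text \<open>Derandomizes the random order one vertex at a time. By \<open>mean_log_average\<close>,
  the right-hand side averaged over all \<open>v\<close> in \<open>S\<close> equals the left-hand
  side, so some \<open>v\<close> reaches the average.\<close>

lemma exists_good_last_vertex:
  assumes "finite S" "S \<noteq> {}" "\<And>v. {v} \<notin> E"
  obtains v where "v \<in> S"
    "(\<Sum>u\<in>S. mean_log q (card (nbrs E S u)))
       \<le> ln (real (q - card (nbrs E S v))) + (\<Sum>u\<in>S - {v}. mean_log q (card (nbrs E (S - {v}) u)))"
proof -
  let ?g = "\<lambda>v. ln (real (q - card (nbrs E S v)))
              + (\<Sum>u\<in>S - {v}. mean_log q (card (nbrs E (S - {v}) u)))"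
  let ?T = "\<Sum>u\<in>S. mean_log q (card (nbrs E S u))"
  have flip: "(\<Sum>v\<in>S. \<Sum>u\<in>S - {v}. h u v) = (\<Sum>u\<in>S. \<Sum>v\<in>S - {u}. h u v)"
    for h :: "'a \<Rightarrow> 'a \<Rightarrow> real"
  proof -
    have eq: "S - {v} = {u \<in> S. u \<noteq> v}" "S - {v} = {u \<in> S. v \<noteq> u}" for v
      by auto
    show ?thesis
      unfolding eq(1)
      by (subst sum.swap_restrict) (auto simp: assms intro!: sum.cong)
  qed
  have "(\<Sum>v\<in>S. ?g v) = (\<Sum>u\<in>S. ln (real (q - card (nbrs E S u)))
          + (\<Sum>v\<in>S - {u}. mean_log q (card (nbrs E (S - {v}) u))))"
    by (simp add: sum.distrib flip[of "\<lambda>u v. mean_log q (card (nbrs E (S - {v}) u))"])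
  also have "\<dots> = (\<Sum>u\<in>S. real (card S) * mean_log q (card (nbrs E S u)))"
    using assms by (intro sum.cong mean_log_average) auto
  also have "\<dots> = (\<Sum>v\<in>S. ?T)"
    by (simp add: sum_distrib_left)
  finally have total: "(\<Sum>v\<in>S. ?g v) = (\<Sum>v\<in>S. ?T)" .
  have "\<exists>v\<in>S. ?T \<le> ?g v"
  proof (rule ccontr)
    assume "\<not> (\<exists>v\<in>S. ?T \<le> ?g v)"
    then have "(\<Sum>v\<in>S. ?g v) < (\<Sum>v\<in>S. ?T)"
      using assms by (intro sum_strict_mono) auto
    with total show False by simp
  qed
  then show thesis using that by blast
qed

text \<open>Induction on \<open>card S\<close>: the good vertex is deleted and colored last, and its
  logarithmic term becomes the factor gained by extending the colorings of the rest.\<close>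

lemma exp_mean_log_le_card_proper_colorings:
  assumes "finite S" "\<And>v. {v} \<notin> E" "\<And>v. v \<in> S \<Longrightarrow> card (nbrs E S v) < q"
  shows "exp (\<Sum>v\<in>S. mean_log q (card (nbrs E S v))) \<le> real (card (proper_colorings q E S))"
  using assms(1,3)
proof (induction "card S" arbitrary: S)
  case 0
  then have "S = {}" by simp
  then show ?case by (simp add: proper_colorings_def)
next
  case (Suc k)
  then have "S \<noteq> {}" by auto
  with Suc.prems assms(2) obtain v where v: "v \<in> S"
    "(\<Sum>u\<in>S. mean_log q (card (nbrs E S u)))
       \<le> ln (real (q - card (nbrs E S v))) + (\<Sum>u\<in>S - {v}. mean_log q (card (nbrs E (S - {v}) u)))"
    using exists_good_last_vertex[of S E q] by metis
  have less: "card (nbrs E (S - {v}) u) < q" if "u \<in> S" for u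
  proof -
    have "card (nbrs E (S - {v}) u) \<le> card (nbrs E S u)"
      by (rule card_mono) (auto simp: nbrs_def Suc.prems)
    with Suc.prems(2)[OF that] show ?thesis by simp
  qed
  have IH: "exp (\<Sum>u\<in>S - {v}. mean_log q (card (nbrs E (S - {v}) u)))
      \<le> real (card (proper_colorings q E (S - {v})))"
    using Suc.hyps(2) Suc.prems(1) v(1) less by (intro Suc.hyps(1)) auto
  have nbrs: "nbrs E (S - {v}) v = nbrs E S v"
    using assms(2) by (auto simp: nbrs_def)
  have "exp (\<Sum>u\<in>S. mean_log q (card (nbrs E S u)))
      \<le> exp (ln (real (q - card (nbrs E S v)))) *
          exp (\<Sum>u\<in>S - {v}. mean_log q (card (nbrs E (S - {v}) u)))"
    using v(2) by (simp add: exp_add[symmetric])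
  \<comment> \<open>The degree bound makes \<open>q - card (nbrs E S v)\<close> positive, so
    \<open>exp\<close> undoes \<open>ln\<close>; this would fail at 0, where
    \<open>ln 0 = 0\<close>.\<close>
  also have "\<dots> \<le> real (q - card (nbrs E S v)) * real (card (proper_colorings q E (S - {v})))"
    using Suc.prems(2)[OF v(1)] IH by (simp add: mult_left_mono)
  also have "\<dots> = real ((q - card (nbrs E (S - {v}) v)) * card (proper_colorings q E (S - {v})))"
    by (simp add: nbrs)
  also have "\<dots> \<le> real (card (proper_colorings q E (insert v (S - {v}))))"
    using Suc.prems(1) assms(2) by (intro of_nat_mono card_proper_colorings_insert) auto
  also have "insert v (S - {v}) = S"
    using v(1) by auto
  finally show ?case .
qed

text \<open>Each vertex contributes at least \<open>ln q - 1\<close> to the exponent, whatever its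
  degree, so the bound is \<open>(q / e) ^ card S\<close> out of \<open>q ^ card S\<close>
  colorings.\<close>

lemma card_proper_colorings_ge:
  assumes "finite S" "\<And>v. {v} \<notin> E" "\<And>v. v \<in> S \<Longrightarrow> card (nbrs E S v) < q" "0 < q"
  shows "exp (- real (card S)) * real (card (S \<rightarrow>\<^sub>E {1..q}))
           \<le> real (card (proper_colorings q E S))"
proof -
  have "exp (- real (card S)) * real (card (S \<rightarrow>\<^sub>E {1..q})) = exp (real (card S) * (ln (real q) - 1))"
    using assms by (simp add: card_PiE algebra_simps exp_diff exp_minus exp_of_nat_mult divide_inverse)
  also have "\<dots> \<le> exp (\<Sum>v\<in>S. mean_log q (card (nbrs E S v)))"
    using sum_mono[of S "\<lambda>_. ln (real q) - 1" "\<lambda>v. mean_log q (card (nbrs E S v))"]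
    by (simp add: mean_log_ge assms)
  also have "\<dots> \<le> real (card (proper_colorings q E S))"
    using assms by (intro exp_mean_log_le_card_proper_colorings) auto
  finally show ?thesis .
qed

section \<open>Covering all graphs by few colorings\<close>

text \<open>Double counting of related pairs yields an \<open>x\<close> that covers at least a
  fraction \<open>p\<close> of the elements still uncovered. A list may repeat elements, so
  \<open>t\<close> may exceed \<open>card X\<close>.\<close>

lemma greedy_cover:
  fixes p :: real
  assumes "finite X" "finite Y" "X \<noteq> {}" "p \<le> 1"
    and dense: "\<And>y. y \<in> Y \<Longrightarrow> p * real (card X) \<le> real (card {x \<in> X. R x y})"
  shows "\<exists>xs. length xs = t \<and> set xs \<subseteq> X \<and>
           real (card {y \<in> Y. \<forall>x\<in>set xs. \<not> R x y}) \<le> (1 - p) ^ t * real (card Y)"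
proof (induction t)
  case 0
  show ?case by simp
next
  case (Suc t)
  then obtain xs where xs: "length xs = t" "set xs \<subseteq> X"
    "real (card {y \<in> Y. \<forall>x\<in>set xs. \<not> R x y}) \<le> (1 - p) ^ t * real (card Y)"
    by blast
  define U where "U = {y \<in> Y. \<forall>x\<in>set xs. \<not> R x y}"
  have U: "finite U" "U \<subseteq> Y"
    using assms by (auto simp: U_def)
  have "(\<Sum>x\<in>X. real (card {y \<in> U. R x y})) = (\<Sum>x\<in>X. \<Sum>y\<in>{y \<in> U. R x y}. 1)"
    by simp
  also have "\<dots> = (\<Sum>y\<in>U. \<Sum>x\<in>{x \<in> X. R x y}. 1)"
    by (rule sum.swap_restrict) (use assms U in auto)
  also have "\<dots> \<ge> (\<Sum>y\<in>U. p * real (card X))"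
    using U dense by (intro sum_mono) auto
  finally have total: "(\<Sum>x\<in>X. p * real (card U)) \<le> (\<Sum>x\<in>X. real (card {y \<in> U. R x y}))"
    by (simp add: mult_ac)
  have "\<exists>x\<in>X. p * real (card U) \<le> real (card {y \<in> U. R x y})"
  proof (rule ccontr)
    assume "\<not> ?thesis"
    then have "(\<Sum>x\<in>X. real (card {y \<in> U. R x y})) < (\<Sum>x\<in>X. p * real (card U))"
      using assms by (intro sum_strict_mono) auto
    with total show False by simp
  qed
  then obtain x where x: "x \<in> X" "p * real (card U) \<le> real (card {y \<in> U. R x y})"
    by blast
  have "{y \<in> Y. \<forall>x'\<in>set (x # xs). \<not> R x' y} = U - {y \<in> U. R x y}"
    by (auto simp: U_def)
  then have "real (card {y \<in> Y. \<forall>x'\<in>set (x # xs). \<not> R x' y}) = real (card U) - real (card {y \<in> U. R x y})"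
    using U by (simp add: card_Diff_subset card_mono)
  also have "\<dots> \<le> (1 - p) * real (card U)"
    using x by (simp add: algebra_simps)
  also have "\<dots> \<le> (1 - p) * ((1 - p) ^ t * real (card Y))"
    using xs(3) assms(4) by (intro mult_left_mono) (auto simp: U_def)
  finally show ?case
    using xs x by (intro exI[of _ "x # xs"]) auto
qed

lemma square_less_4_power: "n\<^sup>2 < (4::nat) ^ n"
proof -
  have "n < 2 ^ n" by (rule less_exp)
  then have "n\<^sup>2 < (2 ^ n)\<^sup>2"
    by (intro power_strict_mono) auto
  then show ?thesis
    by (simp add: power2_eq_square power_mult_distrib[symmetric])
qed

text \<open>Explains the base 16 = 4 * 4: one factor 4 absorbs \<open>e\<close>, the other leaves
  \<open>exp (- (4 ^ n))\<close>, which beats the number of graphs.\<close>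

lemma uncovered_graphs_bound_less_1:
  "(1 - exp (- real n)) ^ (16 ^ n) * 2 ^ (n choose 2) < (1::real)"
proof -
  have "(1 - exp (- real n)) ^ (16 ^ n) \<le> exp (- exp (- real n)) ^ (16 ^ n)"
    using exp_ge_add_one_self[of "- exp (- real n)"] by (intro power_mono) auto
  also have "\<dots> = exp (- (16 ^ n * exp (- real n)))"
    by (simp add: exp_of_nat_mult[symmetric])
  also have "\<dots> \<le> exp (- (4 ^ n))"
  proof -
    have "exp 1 \<le> (4::real)"
      using exp_le by simp
    then have "exp (real n) \<le> 4 ^ n"
      using power_mono[of "exp 1" "4::real" n] by (simp add: exp_of_nat_mult[symmetric])
    then have "4 ^ n * exp (real n) \<le> 4 ^ n * (4::real) ^ n"
      by (intro mult_left_mono) auto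
    also have "\<dots> = 16 ^ n"
      by (simp add: power_mult_distrib[symmetric])
    finally show ?thesis
      by (simp add: exp_minus field_simps)
  qed
  finally have 1: "(1 - exp (- real n)) ^ (16 ^ n) \<le> exp (- (4 ^ n))" .
  have "(2::real) ^ (n choose 2) \<le> exp 1 ^ (n choose 2)"
    using exp_ge_add_one_self[of 1] by (intro power_mono) auto
  also have "\<dots> = exp (real (n choose 2))"
    by (simp add: exp_of_nat_mult[symmetric])
  also have "\<dots> < exp (4 ^ n)"
  proof -
    have "n choose 2 \<le> n\<^sup>2"
      by (simp add: choose_two power2_eq_square le_trans[OF div_le_dividend])
    then have "n choose 2 < 4 ^ n"
      using square_less_4_power[of n] by linarith
    then have "real (n choose 2) < real (4 ^ n)"
      by (simp only: of_nat_less_iff)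
    then show ?thesis by simp
  qed
  finally have 2: "(2::real) ^ (n choose 2) < exp (4 ^ n)" .
  have "(1 - exp (- real n)) ^ (16 ^ n) * 2 ^ (n choose 2) \<le> exp (- (4 ^ n)) * 2 ^ (n choose 2)"
    using 1 by (intro mult_right_mono) auto
  also have "\<dots> < exp (- (4 ^ n)) * exp (4 ^ n)"
    using 2 by (intro mult_strict_left_mono) auto
  also have "\<dots> = 1"
    by (simp add: exp_minus)
  finally show ?thesis .
qed

section \<open>A universal family of colorings for graphs of bounded degree\<close>

lemma card_nbrs_le_degree:
  assumes "finite E"
  shows "card (nbrs E S v) \<le> degree E v"
  unfolding degree_def
proof (rule card_inj_on_le)
  show "inj_on (\<lambda>u. {u, v}) (nbrs E S v)"
    by (auto simp: inj_on_def doubleton_eq_iff)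
  show "(\<lambda>u. {u, v}) ` nbrs E S v \<subseteq> {e \<in> E. v \<in> e}"
    by (auto simp: nbrs_def)
  show "finite {e \<in> E. v \<in> e}"
    using assms by simp
qed

lemma degree_le_max_degree: "v \<in> {1..n} \<Longrightarrow> degree E v \<le> max_degree n E"
  unfolding max_degree_def by (intro cSUP_upper) auto

lemma proper_colorings_simple_graph:
  assumes "simple_graph n E"
  shows "C \<in> proper_colorings k E {1..n} \<longleftrightarrow> proper_coloring n k E C"
  using assms by (auto simp: proper_colorings_def proper_coloring_def simple_graph_def)

text \<open>Greedy covering with density \<open>exp (- n)\<close> against at most
  \<open>2 ^ (n choose 2)\<close> graphs leaves fewer than one graph uncovered, hence none.\<close>

lemma exists_universal_colorings:
  obtains Cs where "length Cs = 16 ^ n"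
    "\<And>E. simple_graph n E \<Longrightarrow> max_degree n E \<le> \<Delta> \<Longrightarrow> \<exists>C\<in>set Cs. proper_coloring n (\<Delta> + 1) E C"
proof -
  define X where "X = {1..n} \<rightarrow>\<^sub>E {1..\<Delta> + 1}"
  define P where "P = {e. e \<subseteq> {1..n} \<and> card e = 2}"
  define Y where "Y = {E. simple_graph n E \<and> max_degree n E \<le> \<Delta>}"
  have X: "finite X" "X \<noteq> {}"
    by (auto simp: X_def finite_PiE PiE_eq_empty_iff)
  have P: "finite P" "card P = n choose 2"
    using n_subsets[of "{1..n}" 2] by (auto simp: P_def)
  have YP: "Y \<subseteq> Pow P"
    by (auto simp: Y_def P_def simple_graph_def)
  have Y: "finite Y"
    using YP P(1) by (meson finite_Pow_iff finite_subset)
  have "card Y \<le> 2 ^ (n choose 2)"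
    using card_mono[OF _ YP] P by (simp add: card_Pow)
  then have cardY: "real (card Y) \<le> 2 ^ (n choose 2)"
    by (metis of_nat_le_iff of_nat_numeral of_nat_power)
  have dense: "exp (- real n) * real (card X) \<le> real (card {C \<in> X. proper_coloring n (\<Delta> + 1) E C})"
    if "E \<in> Y" for E
  proof -
    have E: "simple_graph n E" "max_degree n E \<le> \<Delta>" "finite E"
      using that YP P(1) by (auto simp: Y_def intro: finite_subset)
    have "card (nbrs E {1..n} v) < \<Delta> + 1" if "v \<in> {1..n}" for v
      using card_nbrs_le_degree[OF E(3), of "{1..n}" v] degree_le_max_degree[OF that, of E] E(2)
      by linarith
    moreover have "{v} \<notin> E" for v
      using E(1) by (force simp: simple_graph_def)
    ultimately have "exp (- real (card {1..n})) * real (card X)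
        \<le> real (card (proper_colorings (\<Delta> + 1) E {1..n}))"
      unfolding X_def by (intro card_proper_colorings_ge) auto
    also have "proper_colorings (\<Delta> + 1) E {1..n} = {C \<in> X. proper_coloring n (\<Delta> + 1) E C}"
      using proper_colorings_simple_graph[OF E(1)] by (auto simp: X_def proper_coloring_def)
    finally show ?thesis by simp
  qed
  obtain Cs where Cs: "length Cs = 16 ^ n"
    "real (card {E \<in> Y. \<forall>C\<in>set Cs. \<not> proper_coloring n (\<Delta> + 1) E C})
       \<le> (1 - exp (- real n)) ^ (16 ^ n) * real (card Y)"
    using greedy_cover[OF X(1) Y X(2), where R = "\<lambda>C E. proper_coloring n (\<Delta> + 1) E C"
        and p = "exp (- real n)" and t = "16 ^ n"] dense by auto
  note Cs(2)
  also have "(1 - exp (- real n)) ^ (16 ^ n) * real (card Y)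
      \<le> (1 - exp (- real n)) ^ (16 ^ n) * 2 ^ (n choose 2)"
    using cardY by (intro mult_left_mono) auto
  also have "\<dots> < 1"
    by (rule uncovered_graphs_bound_less_1)
  finally have "card {E \<in> Y. \<forall>C\<in>set Cs. \<not> proper_coloring n (\<Delta> + 1) E C} = 0"
    by linarith
  then have "{E \<in> Y. \<forall>C\<in>set Cs. \<not> proper_coloring n (\<Delta> + 1) E C} = {}"
    using Y by simp
  then show thesis
    using Cs(1) that[of Cs] by (auto simp: Y_def)
qed

section \<open>The protocol\<close>

text \<open>This lets the players verify a coloring without communicating: each checks only their
  own edges.\<close>

lemma proper_coloring_Un:
  "proper_coloring n k (EA \<union> EB) C \<longleftrightarrow> proper_coloring n k EA C \<and> proper_coloring n k EB C"
  by (auto simp: proper_coloring_def)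

lemma exists_nd_coloring_protocol:
  "\<exists>P. nd_coloring_protocol n \<Delta> P \<and> msg_length P = 4 * n"
proof -
  obtain Cs where Cs: "length Cs = 16 ^ n"
    "\<And>E. simple_graph n E \<Longrightarrow> max_degree n E \<le> \<Delta> \<Longrightarrow> \<exists>C\<in>set Cs. proper_coloring n (\<Delta> + 1) E C"
    using exists_universal_colorings[of n \<Delta>] by metis
  \<comment> \<open>Since \<open>16 ^ n = 2 ^ (4 * n)\<close>, the messages match the list positions
    exactly, so each one names a list entry.\<close>
  have "card {m :: bool list. length m = 4 * n} = card {..<length Cs}"
    using card_lists_length_eq[of "UNIV :: bool set" "4 * n"] by (simp add: Cs(1) power_mult)
  moreover have "finite {m :: bool list. length m = 4 * n}"
    using finite_lists_length_eq[of "UNIV :: bool set" "4 * n"] by simp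
  ultimately obtain idx where idx: "bij_betw idx {m :: bool list. length m = 4 * n} {..<length Cs}"
    using finite_same_card_bij by blast
  \<comment> \<open>The check also tests membership in the set of colorings, so acceptance by both
    is equivalent to properness on the whole graph.\<close>
  define player where "player E m =
    (if proper_coloring n (\<Delta> + 1) E (Cs ! idx m) then Some (Cs ! idx m) else None)" for E m
  define P where
    "P = \<lparr>msg_length = 4 * n, encoded = (\<lambda>m. Cs ! idx m), alice = player, bob = player\<rparr>"
  have "\<exists>m. length m = 4 * n \<and> player EA m \<noteq> None \<and> player EB m \<noteq> None"
    if "edge_partition_input n \<Delta> EA EB" for EA EB
  proof -
    have "simple_graph n (EA \<union> EB)" "max_degree n (EA \<union> EB) \<le> \<Delta>"
      using that by (auto simp: edge_partition_input_def)
    then obtain C where "C \<in> set Cs" and C: "proper_coloring n (\<Delta> + 1) (EA \<union> EB) C"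
      using Cs(2) by blast
    then obtain i where i: "i < length Cs" "Cs ! i = C"
      by (auto simp: in_set_conv_nth)
    then have "i \<in> idx ` {m. length m = 4 * n}"
      using idx by (simp add: bij_betw_imp_surj_on)
    then obtain m where "length m = 4 * n" "idx m = i"
      by blast
    with i C show ?thesis
      by (intro exI[of _ m]) (simp add: player_def proper_coloring_Un)
  qed
  then have "nd_coloring_protocol n \<Delta> P"
    by (auto simp: nd_coloring_protocol_def P_def player_def proper_coloring_Un split: if_splits)
  then show ?thesis
    by (intro exI[of _ P]) (simp add: P_def)
qed

theorem theorem3p1:
  "\<exists>(P :: nat \<Rightarrow> nat \<Rightarrow> nd_protocol) (c :: nat). \<forall>n \<Delta>.
     nd_coloring_protocol n \<Delta> (P n \<Delta>) \<and> msg_length (P n \<Delta>) \<le> c * n"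
proof -
  \<comment> \<open>The protocol is chosen separately for each \<open>n\<close> and
    \<open>\<Delta>\<close>, which both players know; the constant 4 is uniform.\<close>
  obtain P where "\<And>n \<Delta>. nd_coloring_protocol n \<Delta> (P n \<Delta>) \<and> msg_length (P n \<Delta>) = 4 * n"
    using exists_nd_coloring_protocol by metis
  then have "\<forall>n \<Delta>. nd_coloring_protocol n \<Delta> (P n \<Delta>) \<and> msg_length (P n \<Delta>) \<le> 4 * n"
    by simp
  then show ?thesis by blast
qed

end
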